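(* Let a finite group $\Gamma$ act on a finite set $X$, and consider a run of the Construction described below which performs $k-1$ iterations with $k\ge 2$, producing the labelling $\phi:X\to\{1,\dots,k\}$, groups $\Gamma_1\supseteq\cdots\supseteq\Gamma_k$ and sets $X_1\supseteq\cdots\supseteq X_k$. Then there exist elements $y_1,\dots,y_k\in X$ such that (1) $\phi(y_i)=i$ for each $i$, and (2) $y_{i+1}\in\Gamma_{i-1}.y_i$ for each $i$ from $2$ to $k-1$, and $y_1\in\Gamma_{k-1}.y_k$.
   Context: For a group $H$ acting on a set $Y$, write $h.y$ for the action, $H.y$ for the orbit, and $\mathrm{Stab}_H(Z)=\{h\in H: h.z=z \text{ for all } z\in Z\}$. Construction: (1) Set $i=1$, $\phi(x)=1$ for all $x\in X$, $\Gamma_1=\Gamma$, $X_1=X$. (2) While some element of $\Gamma_i$ moves some element of $X_i$: (a) choose a subset $X'_{i+1}\subseteq X_i$ containing exactly one element from each $\Gamma_i$-orbit in $X_i$ having at least two elements (and no other elements); (b) set $\phi(x)=i+1$ for each $x\in X'_{i+1}$; (c) set $X_{i+1}=X_i\setminus X'_{i+1}$ and $\Gamma_{i+1}=\mathrm{Stab}_{\Gamma_i}(X'_{i+1})$; (d) increase $i$ by $1$. *)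

theory Defs
  imports "HOL-Algebra.Group_Action"
begin

definition pointwise_stabilizer ::
  "('g, 'm) monoid_scheme \<Rightarrow> ('g \<Rightarrow> 'x \<Rightarrow> 'x) \<Rightarrow> 'x set \<Rightarrow> 'g set" where
  "pointwise_stabilizer H act Z = {h \<in> carrier H. \<forall>z\<in>Z. act h z = z}"

definition moves_some ::
  "('g, 'm) monoid_scheme \<Rightarrow> 'x set \<Rightarrow> ('g \<Rightarrow> 'x \<Rightarrow> 'x) \<Rightarrow> bool" where
  "moves_some H Y act \<longleftrightarrow> (\<exists>h\<in>carrier H. \<exists>x\<in>Y. act h x \<noteq> x)"

definition orbit_choice ::
  "('g, 'm) monoid_scheme \<Rightarrow> 'x set \<Rightarrow> ('g \<Rightarrow> 'x \<Rightarrow> 'x) \<Rightarrow> 'x set \<Rightarrow> bool" where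
  "orbit_choice H Y act Z \<longleftrightarrow>
     Z \<subseteq> Y \<and>
     (\<forall>A\<in>orbits H Y act. card A \<ge> 2 \<longrightarrow> (\<exists>!z. z \<in> Z \<inter> A)) \<and>
     Z \<subseteq> \<Union>{A \<in> orbits H Y act. card A \<ge> 2}"

text \<open>
  A complete run of the while loop, with loop counter going from \<open>1\<close> to its final value \<open>k\<close>
  (hence \<open>k - 1\<close> iterations). \<open>\<Gamma> i\<close>, \<open>Xs i\<close> and \<open>\<phi> i\<close> are the values of the group, the set and
  the labelling when the counter equals \<open>i\<close>, so the labelling produced by the run is \<open>\<phi> k\<close>.
  The set chosen in the iteration with counter \<open>i\<close> is \<open>C (Suc i)\<close>.
  The sequences are unconstrained outside these index ranges, and \<open>\<phi> i\<close> outside \<open>X\<close>.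
\<close>

definition construction_run ::
  "('g, 'm) monoid_scheme \<Rightarrow> 'x set \<Rightarrow> ('g \<Rightarrow> 'x \<Rightarrow> 'x) \<Rightarrow> nat \<Rightarrow>
   (nat \<Rightarrow> ('g, 'm) monoid_scheme) \<Rightarrow> (nat \<Rightarrow> 'x set) \<Rightarrow> (nat \<Rightarrow> 'x set) \<Rightarrow>
   (nat \<Rightarrow> 'x \<Rightarrow> nat) \<Rightarrow> bool" where
  "construction_run G X act k \<Gamma> Xs C \<phi> \<longleftrightarrow>
     k \<ge> 1 \<and>
     \<Gamma> 1 = G \<and> Xs 1 = X \<and> (\<forall>x\<in>X. \<phi> 1 x = 1) \<and>
     (\<forall>i\<in>{1..<k}.
        moves_some (\<Gamma> i) (Xs i) act \<and>
        orbit_choice (\<Gamma> i) (Xs i) act (C (Suc i)) \<and>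
        (\<forall>x\<in>X. \<phi> (Suc i) x = (if x \<in> C (Suc i) then Suc i else \<phi> i x)) \<and>
        Xs (Suc i) = Xs i - C (Suc i) \<and>
        \<Gamma> (Suc i) = (\<Gamma> i)\<lparr>carrier := pointwise_stabilizer (\<Gamma> i) act (C (Suc i))\<rparr>) \<and>
     \<not> moves_some (\<Gamma> k) (Xs k) act"

end

theory Submission
  imports Defs
begin

text \<open>
  The sequence is built downwards from any \<open>y\<^sub>k \<in> C k\<close>. An element of \<open>C (i + 1)\<close> is moved by
  \<open>\<Gamma> i\<close>, hence by the larger group \<open>\<Gamma> (i - 1)\<close>, so its \<open>\<Gamma> (i - 1)\<close>-orbit contains a chosen element
  \<open>y\<^sub>i \<in> C i\<close>. Finally the \<open>\<Gamma> (k - 1)\<close>-orbit of \<open>y\<^sub>k\<close> has a second element; it is not chosen in the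
  last iteration, so it survives in \<open>Xs k\<close> and carries the label \<open>1\<close>.
\<close>

section \<open>Orbits and pointwise stabilizers for subgroups of the acting group\<close>

lemma (in group_action) orbit_sym_subgroup:
  assumes "subgroup (carrier H) G" and "x \<in> E" and "y \<in> orbit H \<phi> x"
  shows "x \<in> orbit H \<phi> y"
proof -
  obtain h where h: "h \<in> carrier H" "y = \<phi> h x"
    using assms(3) unfolding orbit_def by blast
  then have "h \<in> carrier G"
    using assms(1) subgroup.mem_carrier by fast
  then have "\<phi> (inv h) y = x"
    using h assms(2) orbit_sym_aux by simp
  moreover have "inv h \<in> carrier H"
    using assms(1) h subgroup.m_inv_closed by fast
  ultimately show ?thesis
    unfolding orbit_def by force
qed

lemma (in group_action) orbit_refl_subgroup:
  assumes "subgroup (carrier H) G" and "x \<in> E"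
  shows "x \<in> orbit H \<phi> x"
proof -
  have "\<phi> \<one> x = x"
    using assms(2) id_eq_one by (metis restrict_apply')
  then show ?thesis
    using subgroup.one_closed[OF assms(1)] unfolding orbit_def by force
qed

lemma (in group_action) pointwise_stabilizer_subgroup:
  assumes H: "subgroup (carrier H) G" and Z: "Z \<subseteq> E"
  shows "subgroup (pointwise_stabilizer H \<phi> Z) G"
proof -
  interpret H: subgroup "carrier H" G by (fact H)
  show ?thesis
  proof (rule group.subgroupI[OF group_hom.axioms(1)[OF group_hom]])
    show "pointwise_stabilizer H \<phi> Z \<subseteq> carrier G"
      unfolding pointwise_stabilizer_def by auto
    have "\<phi> \<one> z = z" if "z \<in> Z" for z
      using that Z id_eq_one by (metis restrict_apply' subsetD)
    then have "\<one> \<in> pointwise_stabilizer H \<phi> Z"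
      unfolding pointwise_stabilizer_def by auto
    then show "pointwise_stabilizer H \<phi> Z \<noteq> {}" by blast
  next
    fix a assume a: "a \<in> pointwise_stabilizer H \<phi> Z"
    then have "\<phi> (inv a) z = z" if "z \<in> Z" for z
      using that Z orbit_sym_aux[of a z z] unfolding pointwise_stabilizer_def by auto
    then show "inv a \<in> pointwise_stabilizer H \<phi> Z"
      using a unfolding pointwise_stabilizer_def by auto
  next
    fix a b assume "a \<in> pointwise_stabilizer H \<phi> Z" "b \<in> pointwise_stabilizer H \<phi> Z"
    then show "a \<otimes> b \<in> pointwise_stabilizer H \<phi> Z"
      using Z composition_rule unfolding pointwise_stabilizer_def by (auto simp: subset_iff)
  qed
qed

text \<open>Since \<open>h\<close> is injective and fixes every point of \<open>Z\<close>, a point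
  sent into \<open>Z\<close> must already be its own image. This keeps each \<open>Xs i\<close>
  invariant after chosen points are removed.\<close>

lemma (in group_action) stabilizer_preserves_Diff:
  assumes H: "subgroup (carrier H) G" and Y: "Y \<subseteq> E" "Z \<subseteq> E"
    and inv: "\<And>h x. h \<in> carrier H \<Longrightarrow> x \<in> Y \<Longrightarrow> \<phi> h x \<in> Y"
    and h: "h \<in> pointwise_stabilizer H \<phi> Z" and x: "x \<in> Y - Z"
  shows "\<phi> h x \<in> Y - Z"
proof -
  have hH: "h \<in> carrier H" and fix_Z: "\<And>z. z \<in> Z \<Longrightarrow> \<phi> h z = z"
    using h unfolding pointwise_stabilizer_def by auto
  have hG: "h \<in> carrier G"
    using hH H subgroup.mem_carrier by fast
  have "x \<in> Z" if "\<phi> h x \<in> Z"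
  proof -
    have "\<phi> h (\<phi> h x) = \<phi> h x" using fix_Z that .
    then have "\<phi> h x = x"
      using inj_prop[OF hG] Y that x by (meson DiffD1 inj_onD subsetD)
    then show ?thesis using that by simp
  qed
  then show ?thesis
    using inv[OF hH] x by blast
qed

text \<open>Finiteness matters because \<open>card\<close> is 0 on infinite sets.\<close>

lemma card_ge_2_iff_other:
  assumes "finite A" and "x \<in> A"
  shows "card A \<ge> 2 \<longleftrightarrow> (\<exists>y\<in>A. y \<noteq> x)"
proof
  assume "card A \<ge> 2"
  then have "\<not> A \<subseteq> {x}"
    using card_mono[of "{x}" A] by auto
  then show "\<exists>y\<in>A. y \<noteq> x" by blast
next
  assume "\<exists>y\<in>A. y \<noteq> x"
  then obtain y where "y \<in> A" "y \<noteq> x" by blast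
  then show "card A \<ge> 2"
    using card_mono[of A "{x, y}"] assms by simp
qed

section \<open>Invariants of a fixed run of the construction\<close>

locale finite_construction_run = group_action G X act
  for G :: "('g, 'm) monoid_scheme" (structure) and X :: "'x set" and act +
  fixes k :: nat and \<Gamma> :: "nat \<Rightarrow> ('g, 'm) monoid_scheme" and Xs C :: "nat \<Rightarrow> 'x set"
    and lab :: "nat \<Rightarrow> 'x \<Rightarrow> nat"
  assumes finite_carrier: "finite (carrier G)"
    and run: "construction_run G X act k \<Gamma> Xs C lab"
begin

lemma run_init: "\<Gamma> 1 = G" "Xs 1 = X" "x \<in> X \<Longrightarrow> lab 1 x = 1"
  using run unfolding construction_run_def by auto

lemma run_step:
  assumes "1 \<le> i" "i < k"
  shows "moves_some (\<Gamma> i) (Xs i) act"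
    and "orbit_choice (\<Gamma> i) (Xs i) act (C (Suc i))"
    and "x \<in> X \<Longrightarrow> lab (Suc i) x = (if x \<in> C (Suc i) then Suc i else lab i x)"
    and "Xs (Suc i) = Xs i - C (Suc i)"
    and "carrier (\<Gamma> (Suc i)) = pointwise_stabilizer (\<Gamma> i) act (C (Suc i))"
  using run assms unfolding construction_run_def by auto

lemma choice_subset: "1 \<le> i \<Longrightarrow> i < k \<Longrightarrow> C (Suc i) \<subseteq> Xs i"
  using run_step(2) unfolding orbit_choice_def by blast

text \<open>The three facts go through one induction because they feed each other: passing to the
  stabilizer needs the chosen set inside \<open>X\<close>, and invariance of the smaller set needs
  the subgroup property and the previous invariance.\<close>

lemma run_invariant:
  assumes "1 \<le> i" "i \<le> k"
  shows "subgroup (carrier (\<Gamma> i)) G \<and> Xs i \<subseteq> X \<and>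
    (\<forall>h\<in>carrier (\<Gamma> i). \<forall>x\<in>Xs i. act h x \<in> Xs i)"
  using assms
proof (induction i rule: nat_induct_at_least)
  case base
  then show ?case
    using group.subgroup_self[OF group_hom.axioms(1)[OF group_hom]] element_image
    by (auto simp: run_init simp del: One_nat_def)
next
  case (Suc i)
  then have IH: "subgroup (carrier (\<Gamma> i)) G" "Xs i \<subseteq> X"
    "\<And>h x. h \<in> carrier (\<Gamma> i) \<Longrightarrow> x \<in> Xs i \<Longrightarrow> act h x \<in> Xs i"
    by auto
  have i: "1 \<le> i" "i < k" using Suc by auto
  have C: "C (Suc i) \<subseteq> X" using choice_subset[OF i] IH(2) by blast
  show ?case
    using pointwise_stabilizer_subgroup[OF IH(1) C]
      stabilizer_preserves_Diff[OF IH(1,2) C IH(3)] IH(2)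
    unfolding run_step(4,5)[OF i] by blast
qed

lemmas \<Gamma>_subgroup = run_invariant[THEN conjunct1]
  and Xs_subset = run_invariant[THEN conjunct2, THEN conjunct1]

lemma Xs_invariant: "1 \<le> i \<Longrightarrow> i \<le> k \<Longrightarrow> x \<in> Xs i \<Longrightarrow> orbit (\<Gamma> i) act x \<subseteq> Xs i"
  using run_invariant unfolding orbit_def by blast

text \<open>An orbit is an image of the finite group, so the test \<open>card A \<ge> 2\<close> in
  \<open>orbit_choice\<close> really means having a second point.\<close>

lemma finite_orbit:
  assumes "1 \<le> i" "i \<le> k"
  shows "finite (orbit (\<Gamma> i) act x)"
proof -
  have "finite (carrier (\<Gamma> i))"
    using \<Gamma>_subgroup[OF assms] finite_carrier by (meson finite_subset subgroup.subset)
  then have "finite ((\<lambda>g. act g x) ` carrier (\<Gamma> i))" by simp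
  then show ?thesis
    unfolding orbit_def by (simp add: Setcompr_eq_image)
qed

lemma card_orbit_ge_2_iff:
  assumes "1 \<le> i" "i \<le> k" "x \<in> X"
  shows "card (orbit (\<Gamma> i) act x) \<ge> 2 \<longleftrightarrow> (\<exists>y\<in>orbit (\<Gamma> i) act x. y \<noteq> x)"
  by (rule card_ge_2_iff_other[OF finite_orbit[OF assms(1,2)]
    orbit_refl_subgroup[OF \<Gamma>_subgroup[OF assms(1,2)] assms(3)]])

text \<open>Working form of \<open>orbit_choice\<close>. Existence yields predecessors in the
  sequence; uniqueness shows that a second point of an orbit with a chosen point stays
  unchosen.\<close>

lemma chosen_in_moved_orbit:
  assumes i: "1 \<le> i" "i < k" and x: "x \<in> Xs i" and y: "y \<in> orbit (\<Gamma> i) act x" "y \<noteq> x"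
  shows "\<exists>!z. z \<in> C (Suc i) \<inter> orbit (\<Gamma> i) act x"
proof -
  have "x \<in> X" using x Xs_subset[of i] i by auto
  then have "card (orbit (\<Gamma> i) act x) \<ge> 2"
    using card_orbit_ge_2_iff[of i x] i y by auto
  moreover have "orbit (\<Gamma> i) act x \<in> orbits (\<Gamma> i) (Xs i) act"
    using x unfolding orbits_def by blast
  ultimately show ?thesis
    using run_step(2)[OF i] unfolding orbit_choice_def by blast
qed

lemma chosen_is_moved:
  assumes i: "1 \<le> i" "i < k" and z: "z \<in> C (Suc i)"
  shows "\<exists>y\<in>orbit (\<Gamma> i) act z. y \<noteq> z"
proof -
  obtain x where x: "x \<in> Xs i" "z \<in> orbit (\<Gamma> i) act x" "card (orbit (\<Gamma> i) act x) \<ge> 2"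
    using run_step(2)[OF i] z unfolding orbit_choice_def orbits_def by blast
  have X: "x \<in> X" using x Xs_subset[of i] i by auto
  have sub: "subgroup (carrier (\<Gamma> i)) G" using \<Gamma>_subgroup i by simp
  \<comment> \<open>The orbit comes with a representative \<open>x\<close>. If \<open>z\<close>
    differs from \<open>x\<close>, symmetry makes \<open>x\<close> itself the other point.\<close>
  show ?thesis
  proof (cases "z = x")
    case True
    then show ?thesis using card_orbit_ge_2_iff[of i x] i X x(3) by auto
  next
    case False
    then show ?thesis using orbit_sym_subgroup[OF sub X x(2)] by auto
  qed
qed

text \<open>The loop condition supplies a moved point, and its orbit contains a chosen one. For the
  last iteration this gives the starting point of the descent.\<close>

lemma choice_nonempty:
  assumes i: "1 \<le> i" "i < k"
  shows "C (Suc i) \<noteq> {}"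
proof -
  obtain h x where "h \<in> carrier (\<Gamma> i)" "x \<in> Xs i" "act h x \<noteq> x"
    using run_step(1)[OF i] unfolding moves_some_def by blast
  then show ?thesis
    using chosen_in_moved_orbit[OF i, of x "act h x"] unfolding orbit_def by blast
qed

text \<open>A label above 1 is never overwritten: a chosen point leaves \<open>Xs\<close>, and all
  later choices are taken from \<open>Xs\<close>. The clause \<open>x \<notin> Xs i\<close> carries
  this through the induction.\<close>

lemma label_eq:
  assumes "1 \<le> i" "i \<le> k"
  shows "(\<forall>x\<in>Xs i. lab i x = 1) \<and>
    (\<forall>j\<in>{2..i}. \<forall>x\<in>C j. x \<in> X \<and> x \<notin> Xs i \<and> lab i x = j)"
  using assms
proof (induction i rule: nat_induct_at_least)
  case base
  then show ?case by (simp add: run_init del: One_nat_def)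
next
  case (Suc i)
  have i: "1 \<le> i" "i < k" using Suc by auto
  have IH: "\<forall>x\<in>Xs i. lab i x = 1" "\<forall>j\<in>{2..i}. \<forall>x\<in>C j. x \<in> X \<and> x \<notin> Xs i \<and> lab i x = j"
    using Suc by auto
  have X: "Xs i \<subseteq> X" using Xs_subset[of i] i by auto
  have "x \<in> X \<and> x \<notin> Xs (Suc i) \<and> lab (Suc i) x = j" if "j \<in> {2..Suc i}" "x \<in> C j" for j x
  proof (cases "j = Suc i")
    case True
    then show ?thesis
      using that X choice_subset[OF i] run_step(3,4)[OF i] by auto
  next
    case False
    then have "x \<in> X" "x \<notin> Xs i" "lab i x = j" using that IH(2) by auto
    then show ?thesis
      using choice_subset[OF i] run_step(3,4)[OF i] by auto
  qed
  moreover have "\<forall>x\<in>Xs (Suc i). lab (Suc i) x = 1"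
    using run_step(3,4)[OF i] IH(1) X by auto
  ultimately show ?case by blast
qed

section \<open>Descent through the chosen points and closing of the cycle\<close>

lemma chosen_predecessor:
  assumes i: "2 \<le> i" "i < k" and z: "z \<in> C (Suc i)"
  shows "\<exists>y\<in>C i. z \<in> orbit (\<Gamma> (i - 1)) act y"
proof -
  obtain m where m: "i = Suc m" "1 \<le> m" "m < k" using i by (cases i) auto
  have zX: "z \<in> Xs m"
    using choice_subset[of i] run_step(4)[OF m(2,3)] z i m(1) by auto
  have X: "z \<in> X" using Xs_subset[of m] m zX by auto
  obtain y where y: "y \<in> orbit (\<Gamma> i) act z" "y \<noteq> z"
    using chosen_is_moved[of i z] i z by auto
  \<comment> \<open>\<open>\<Gamma> i\<close> is a stabilizer inside \<open>\<Gamma> m\<close>, so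
    whatever moves \<open>z\<close> at stage \<open>i\<close> moves it at stage \<open>m\<close>
    too.\<close>
  have "orbit (\<Gamma> i) act z \<subseteq> orbit (\<Gamma> m) act z"
    using run_step(5)[OF m(2,3)] unfolding m(1) orbit_def pointwise_stabilizer_def by auto
  then obtain w where w: "w \<in> C i" "w \<in> orbit (\<Gamma> m) act z"
    using chosen_in_moved_orbit[OF m(2,3) zX _ y(2)] y(1) m(1) by blast
  then have "z \<in> orbit (\<Gamma> m) act w"
    using orbit_sym_subgroup[OF _ X w(2)] \<Gamma>_subgroup[of m] m by auto
  then show ?thesis using w m(1) by auto
qed

text \<open>The endpoint \<open>z\<close> stays arbitrary in the induction, so that the shorter
  sequence can be made to end at the predecessor of \<open>z\<close>.\<close>

lemma chosen_sequence:
  assumes "2 \<le> j" "j \<le> k" "z \<in> C j"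
  shows "\<exists>y. y j = z \<and> (\<forall>i\<in>{2..j}. y i \<in> C i) \<and>
    (\<forall>i\<in>{2..<j}. y (Suc i) \<in> orbit (\<Gamma> (i - 1)) act (y i))"
  using assms
proof (induction j arbitrary: z rule: nat_induct_at_least)
  case base
  then show ?case by (intro exI[of _ "\<lambda>_. z"]) auto
next
  case (Suc j)
  then obtain w where w: "w \<in> C j" "z \<in> orbit (\<Gamma> (j - 1)) act w"
    using chosen_predecessor[of j z] by auto
  obtain y where "y j = w" "\<forall>i\<in>{2..j}. y i \<in> C i"
    "\<forall>i\<in>{2..<j}. y (Suc i) \<in> orbit (\<Gamma> (i - 1)) act (y i)"
    using Suc.IH[OF _ w(1)] Suc.prems by auto
  then show ?case
    using w Suc.prems by (intro exI[of _ "y(Suc j := z)"]) (auto simp: le_Suc_eq less_Suc_eq)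
qed

lemma labelled_cycle:
  assumes k: "2 \<le> k"
  shows "\<exists>y. (\<forall>i\<in>{1..k}. y i \<in> X \<and> lab k (y i) = i) \<and>
    (\<forall>i\<in>{2..<k}. y (Suc i) \<in> orbit (\<Gamma> (i - 1)) act (y i)) \<and>
    y 1 \<in> orbit (\<Gamma> (k - 1)) act (y k)"
proof -
  obtain m where m: "k = Suc m" "1 \<le> m" "m < k" using k by (cases k) auto
  obtain z where z: "z \<in> C k" using choice_nonempty[OF m(2,3)] m(1) by auto
  obtain y where y: "y k = z" "\<forall>i\<in>{2..k}. y i \<in> C i"
    "\<forall>i\<in>{2..<k}. y (Suc i) \<in> orbit (\<Gamma> (i - 1)) act (y i)"
    using chosen_sequence[OF k _ z] by auto
  have zX: "z \<in> Xs m" using choice_subset[OF m(2,3)] z m(1) by auto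
  obtain w where w: "w \<in> orbit (\<Gamma> m) act z" "w \<noteq> z"
    using chosen_is_moved[OF m(2,3)] z m(1) by blast
  have "z \<in> orbit (\<Gamma> m) act z"
    using orbit_refl_subgroup \<Gamma>_subgroup[of m] Xs_subset[of m] m zX by auto
  \<comment> \<open>Both \<open>z\<close> and \<open>w\<close> lie in this orbit and
    \<open>z\<close> is its one chosen point.\<close>
  then have "w \<notin> C k"
    using chosen_in_moved_orbit[OF m(2,3) zX w] w z m(1) by blast
  then have wX: "w \<in> Xs k"
    using Xs_invariant[of m z] m zX w(1) run_step(4)[OF m(2,3)] by auto
  have lab1: "lab k w = 1" "w \<in> X"
    using label_eq[of k] Xs_subset[of k] k wX by auto
  have labs: "y i \<in> X \<and> lab k (y i) = i" if "i \<in> {2..k}" for i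
    using label_eq[of k] k y(2) that by auto
  \<comment> \<open>\<open>y\<close> was constrained only from index 2 on, so its value at 1 is free
    to become \<open>w\<close>.\<close>
  have "(y(1 := w)) i \<in> X \<and> lab k ((y(1 := w)) i) = i" if "i \<in> {1..k}" for i
    using lab1 labs[of i] that by (cases "i = 1") auto
  then show ?thesis
    using y(1,3) w(1) m k by (intro exI[of _ "y(1 := w)"]) auto
qed

end

theorem theorem2p9:
  fixes G :: "('g, 'm) monoid_scheme"
    and X :: "'x set"
    and act :: "'g \<Rightarrow> 'x \<Rightarrow> 'x"
    and k :: nat
    and \<Gamma> :: "nat \<Rightarrow> ('g, 'm) monoid_scheme"
    and Xs :: "nat \<Rightarrow> 'x set"
    and C :: "nat \<Rightarrow> 'x set"
    and \<phi> :: "nat \<Rightarrow> 'x \<Rightarrow> nat"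
  assumes "group_action G X act"
    and "finite (carrier G)"
    and "finite X"
    and "construction_run G X act k \<Gamma> Xs C \<phi>"
    and "k \<ge> 2"
  shows "\<exists>y :: nat \<Rightarrow> 'x.
           (\<forall>i\<in>{1..k}. y i \<in> X) \<and>
           (\<forall>i\<in>{1..k}. \<phi> k (y i) = i) \<and>
           (\<forall>i\<in>{2..k-1}. y (i + 1) \<in> orbit (\<Gamma> (i - 1)) act (y i)) \<and>
           y 1 \<in> orbit (\<Gamma> (k - 1)) act (y k)"
proof -
  interpret finite_construction_run G X act k \<Gamma> Xs C \<phi>
    by (intro finite_construction_run.intro finite_construction_run_axioms.intro assms)
  obtain y where "\<forall>i\<in>{1..k}. y i \<in> X \<and> \<phi> k (y i) = i"
    "\<forall>i\<in>{2..<k}. y (Suc i) \<in> orbit (\<Gamma> (i - 1)) act (y i)"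
    "y 1 \<in> orbit (\<Gamma> (k - 1)) act (y k)"
    using labelled_cycle \<open>k \<ge> 2\<close> by blast
  then show ?thesis by (intro exI[of _ y]) auto
qed

end
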